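(* Let $(\mathbb{S},\oplus,\odot,\mathbf{0},\mathbf{1})$ be an idempotent commutative semiring, let $d\ge1$, and let $z=(z_1,z_2,\dots)$ be an $\mathbb S^d$-valued time series that is eventually constant. Then $\mathrm{ISS}^{\mathbb S,\mathrm{idem}}_{s,t}(z)$ is invariant to time warping. That is, define for $n\ge1$ the time series $\tau_n(z)$ by $\tau_n(z)_j:=z_j$ for $j\le n$ and $\tau_n(z)_j:=z_{j-1}$ for $j>n$. Then, for all $n\ge1$, $$\mathrm{ISS}^{\mathbb S,\mathrm{idem}}_{s,t}(\tau_n(z))=\mathrm{ISS}^{\mathbb S,\mathrm{idem}}_{s,t}(z).$$
   Context: A commutative semiring $(\mathbb S,\oplus,\odot,\mathbf 0,\mathbf 1)$ consists of two commutative monoids $(\mathbb S,\oplus,\mathbf 0)$ and $(\mathbb S,\odot,\mathbf 1)$ such that $\odot$ distributes over $\oplus$ and $\mathbf 0\odot s=\mathbf 0$ for all $s$. It is idempotent if $a\oplus a=a$ for all $a\in\mathbb S$. The alphabet $A$ is the set of all non-constant formal commutative monomials $[a_1\cdots a_m]$ ($m\ge1$, $a_i\in\{1,\dots,d\}$), and $A^*$ is the set of words over $A$. For $z_j=(z_j^{(1)},\dots,z_j^{(d)})\in\mathbb S^d$ and $a=[a_1\cdots a_m]\in A$ put $z_j^{\odot a}:=z_j^{(a_1)}\odot\cdots\odot z_j^{(a_m)}$. For $z$ eventually constant and $1\le s<t\le+\infty$ (and also for $s=0$, $t=+\infty$), $\mathrm{ISS}^{\mathbb S,\mathrm{idem}}_{s,t}(z)$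 is the map $A^*\to\mathbb S$ given, for $w=w_1\cdots w_k$ with $w_i\in A$, by the sum over weakly increasing indices $$\langle \mathrm{ISS}^{\mathbb S,\mathrm{idem}}_{s,t}(z),w\rangle:=\bigoplus_{s<j_1\le j_2\le\cdots\le j_k<t+1} z_{j_1}^{\odot w_1}\odot\cdots\odot z_{j_k}^{\odot w_k},$$ with value $\mathbf 1$ on the empty word. The possibly infinite sum is well-defined because $z$ is eventually constant, so only finitely many distinct summands occur, and $\mathbb S$ is idempotent.
   Formalization: For s ≥ 1 the identity is claimed only if t ≤ n, or if s < n and t = +∞; for other n it fails (e.g. Boolean semiring, d = 1, s = n = 1, t = 2, z the indicator of index 1). For s = 0, t = +∞ it is claimed for all n ≥ 1. *)

theory Defs
  imports "HOL-Analysis.Finite_Cartesian_Product" "HOL-Library.Multiset" "HOL-Library.Extended_Nat"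
begin

text \<open>
  The class \<^class>\<open>comm_semiring_1\<close> is not used as a base because it requires \<open>0 \<noteq> 1\<close>, which
  is not part of the notion of a commutative semiring considered here.
\<close>

class idem_comm_semiring = comm_semiring_0 + comm_monoid_mult +
  assumes plus_idem: "a + a = a"

text \<open>
  The sum of an arbitrary family with finitely many distinct values in an idempotent semiring:
  each distinct value is added once. If there are infinitely many distinct values the
  result is the junk value 0; this does not occur for the sums below (\<open>finite_summands\<close>).
\<close>

definition idem_sum :: "('i \<Rightarrow> 'a::idem_comm_semiring) \<Rightarrow> 'i set \<Rightarrow> 'a" where
  "idem_sum f I = \<Sum>(f ` I)"

lemma idem_sum_eq_sum:
  fixes f :: "'i \<Rightarrow> 'a::idem_comm_semiring"
  assumes "finite I" "I \<noteq> {}"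
  shows "idem_sum f I = sum f I"
proof -
  have absorb: "x + \<Sum>X = \<Sum>X" if "finite X" "x \<in> X" for x :: 'a and X
    by (metis (no_types) add.assoc plus_idem sum.remove that)
  show ?thesis
    using assms unfolding idem_sum_def
  proof (induction I rule: finite_ne_induct)
    case (insert i I)
    then show ?case
      by (cases "f i \<in> f ` I") (simp_all add: insert_absorb absorb flip: insert.IH)
  qed simp
qed

text \<open>
  Formal commutative monomials are multisets of indices. The index set \<open>{1,\<dots>,d}\<close> is rendered
  as a finite type \<open>'d\<close>, so that \<open>d = CARD('d) \<ge> 1\<close>.
\<close>

typedef 'd letter = "{m :: 'd multiset. m \<noteq> {#}}"
  morphisms monomial Abs_letter
  by (rule exI[of _ "{#undefined#}"]) simp

definition monomial_power :: "('a::idem_comm_semiring) ^ 'd \<Rightarrow> 'd letter \<Rightarrow> 'a" where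
  "monomial_power x a = (\<Prod>i\<in>#monomial a. x $ i)"

text \<open>
  A time series \<open>(z\<^sub>1, z\<^sub>2, \<dots>)\<close> is a function on \<^typ>\<open>nat\<close> whose value at 0 is irrelevant.
\<close>

definition eventually_constant :: "(nat \<Rightarrow> 'b) \<Rightarrow> bool" where
  "eventually_constant z \<longleftrightarrow> (\<exists>c. \<forall>\<^sub>F j in sequentially. z j = c)"

definition admissible :: "nat \<Rightarrow> enat \<Rightarrow> bool" where
  "admissible s t \<longleftrightarrow> (1 \<le> s \<and> enat s < t) \<or> (s = 0 \<and> t = \<infinity>)"

definition index_seqs :: "nat \<Rightarrow> enat \<Rightarrow> nat \<Rightarrow> nat list set" where
  "index_seqs s t k = {js. length js = k \<and> sorted js \<and> (\<forall>j\<in>set js. s < j \<and> enat j < t + 1)}"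

definition summand ::
    "(nat \<Rightarrow> 'a::idem_comm_semiring ^ 'd) \<Rightarrow> 'd letter list \<Rightarrow> nat list \<Rightarrow> 'a" where
  "summand z w js = (\<Prod>i<length w. monomial_power (z (js ! i)) (w ! i))"

definition ISS_idem ::
    "nat \<Rightarrow> enat \<Rightarrow> (nat \<Rightarrow> 'a::idem_comm_semiring ^ 'd) \<Rightarrow> 'd letter list \<Rightarrow> 'a" where
  "ISS_idem s t z w = idem_sum (summand z w) (index_seqs s t (length w))"

text \<open>
  The window \<open>(s, t]\<close> does not move with the warp. For \<open>s \<ge> 1\<close>, warping at \<open>n \<le> s\<close> brings
  \<open>z\<^sub>s\<close> into the window, and warping at \<open>s < n < t < \<infinity>\<close> pushes \<open>z\<^sub>t\<close> out of it, so
  time-warping invariance can only be expected for \<open>t \<le> n\<close>, or for \<open>t = \<infinity>\<close> and \<open>s < n\<close>;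
  for \<open>s = 0\<close>, \<open>t = \<infinity>\<close> there is no such restriction on \<open>n \<ge> 1\<close>.
\<close>

definition time_warp :: "nat \<Rightarrow> (nat \<Rightarrow> 'b) \<Rightarrow> nat \<Rightarrow> 'b" where
  "time_warp n z j = (if j \<le> n then z j else z (j - 1))"

lemma finite_summands:
  assumes "eventually_constant z"
  shows "finite (summand z w ` index_seqs s t (length w))"
proof -
  obtain c N where N: "\<And>j. j \<ge> N \<Longrightarrow> z j = c"
    using assms unfolding eventually_constant_def eventually_sequentially by blast
  have "summand z w js \<in> summand z w ` {js. set js \<subseteq> {..N} \<and> length js = length w}"
    if "js \<in> index_seqs s t (length w)" for js
  proof (rule image_eqI)
    have z: "z j = z (min j N)" for j
      using N[of j] N[of N] by (cases "j \<le> N") auto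
    have len: "length js = length w"
      using that by (simp add: index_seqs_def)
    show "summand z w js = summand z w (map (\<lambda>j. min j N) js)"
      unfolding summand_def by (intro prod.cong refl) (use len z in auto)
    show "map (\<lambda>j. min j N) js \<in> {js. set js \<subseteq> {..N} \<and> length js = length w}"
      using len by auto
  qed
  then have "summand z w ` index_seqs s t (length w)
      \<subseteq> summand z w ` {js. set js \<subseteq> {..N} \<and> length js = length w}"
    by blast
  then show ?thesis
    by (rule finite_subset) (intro finite_imageI finite_lists_length_eq finite_atMost)
qed

lemma ISS_idem_Nil: "ISS_idem s t z [] = 1"
proof -
  have "index_seqs s t (length ([] :: 'd letter list)) = {[]}"
    by (auto simp: index_seqs_def)
  then show ?thesis
    by (simp add: ISS_idem_def idem_sum_def summand_def)
qed

end

theory Submission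
  imports Defs
begin

text \<open>
  If the window \<open>(s, t]\<close> ends at or before \<open>n\<close>, the warp does not affect it. Otherwise \<open>s < n\<close> and
  \<open>t = \<infinity>\<close>, and the warped series is \<open>z \<circ> \<sigma>\<close> for the monotone surjection \<open>\<sigma>\<close> that takes the value
  \<open>n\<close> twice. It has a monotone right inverse \<open>\<rho>\<close>, and both preserve the window, so they carry weakly
  increasing index sequences to such sequences. Hence both series have the same set of summands; by
  idempotency only this set matters, not the multiplicities.
\<close>

lemma summand_map:
  assumes "length js = length w"
  shows "summand z w (map f js) = summand (z \<circ> f) w js"
  unfolding summand_def using assms by (intro prod.cong) auto

lemma map_in_index_seqs:
  assumes "js \<in> index_seqs s t k"
    and "mono f"
    and "\<And>j. s < j \<Longrightarrow> enat j < t + 1 \<Longrightarrow> s < f j \<and> enat (f j) < t + 1"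
  shows "map f js \<in> index_seqs s t k"
proof -
  have "sorted (map f js)"
    unfolding sorted_map
    by (rule sorted_wrt_mono_rel[of _ "(\<le>)"]) (use assms(1,2) in \<open>simp_all add: index_seqs_def monoD\<close>)
  then show ?thesis
    using assms(1,3) by (simp add: index_seqs_def)
qed

lemma ISS_idem_cong:
  assumes "\<And>j. s < j \<Longrightarrow> enat j < t + 1 \<Longrightarrow> y j = z j"
  shows "ISS_idem s t y = ISS_idem s t z"
proof
  fix w
  have "summand y w js = summand z w js" if "js \<in> index_seqs s t (length w)" for js
    using that assms unfolding summand_def index_seqs_def by (intro prod.cong) auto
  then show "ISS_idem s t y w = ISS_idem s t z w"
    unfolding ISS_idem_def idem_sum_def by (metis (no_types, lifting) image_cong)
qed

text \<open>\<open>map \<sigma>\<close> need not be injective on the index sequences, but it is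
  onto, with section \<open>map \<rho>\<close>: \<sigma> gives one inclusion between the sets of
  summands, \<rho> the other.\<close>

lemma ISS_idem_reindex:
  fixes z :: "nat \<Rightarrow> 'a::idem_comm_semiring ^ 'd::finite"
  assumes "mono \<sigma>" "mono \<rho>" "\<And>j. \<sigma> (\<rho> j) = j"
    and \<sigma>: "\<And>j. s < j \<Longrightarrow> enat j < t + 1 \<Longrightarrow> s < \<sigma> j \<and> enat (\<sigma> j) < t + 1"
    and \<rho>: "\<And>j. s < j \<Longrightarrow> enat j < t + 1 \<Longrightarrow> s < \<rho> j \<and> enat (\<rho> j) < t + 1"
  shows "ISS_idem s t (z \<circ> \<sigma>) = ISS_idem s t z"
proof
  fix w :: "'d letter list"
  let ?I = "index_seqs s t (length w)"
  have len: "length js = length w" if "js \<in> ?I" for js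
    using that by (simp add: index_seqs_def)
  have "summand (z \<circ> \<sigma>) w ` ?I = summand z w ` ?I"
  proof (intro equalityI image_subsetI)
    fix js assume js: "js \<in> ?I"
    show "summand (z \<circ> \<sigma>) w js \<in> summand z w ` ?I"
      using map_in_index_seqs[OF js \<open>mono \<sigma>\<close> \<sigma>] unfolding summand_map[OF len[OF js], symmetric]
      by blast
    have "summand z w js = summand (z \<circ> \<sigma>) w (map \<rho> js)"
      using assms(3) by (simp add: summand_map[OF len[OF js]] comp_def)
    then show "summand z w js \<in> summand (z \<circ> \<sigma>) w ` ?I"
      using map_in_index_seqs[OF js \<open>mono \<rho>\<close> \<rho>] by blast
  qed
  then show "ISS_idem s t (z \<circ> \<sigma>) w = ISS_idem s t z w"
    by (simp add: ISS_idem_def idem_sum_def)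
qed

theorem lemma4p2:
  fixes z :: "nat \<Rightarrow> 'a::idem_comm_semiring ^ 'd::finite"
    and s n :: nat and t :: enat
  assumes "eventually_constant z"
    and "admissible s t"
    and "n \<ge> 1"
    and "s \<noteq> 0 \<Longrightarrow> t \<le> enat n \<or> (s < n \<and> t = \<infinity>)"
  shows "ISS_idem s t (time_warp n z) = ISS_idem s t z"
proof -
  \<comment> \<open>For \<open>s = 0\<close>, admissibility forces \<open>t = \<infinity>\<close>,
    and \<open>n \<ge> 1\<close> gives \<open>s < n\<close>.\<close>
  consider "t \<le> enat n" | "s < n" "t = \<infinity>"
    using assms by (cases "s = 0") (auto simp: admissible_def)
  then show ?thesis
  proof cases
    case 1
    then obtain m where "t = enat m" "m \<le> n"
      by (cases t) auto
    \<comment> \<open>For finite \<open>t = enat m\<close>, the bound \<open>enat j < t + 1\<close>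
      means \<open>j \<le> m\<close>, hence \<open>j \<le> n\<close>.\<close>
    then show ?thesis
      by (intro ISS_idem_cong) (auto simp: time_warp_def one_enat_def)
  next
    case 2
    define \<sigma> where "\<sigma> j = (if j \<le> n then j else j - 1)" for j
    \<comment> \<open>Of the two preimages \<open>n\<close> and \<open>n + 1\<close> of
      \<open>n\<close> under \<sigma>, \<rho> picks \<open>n\<close> and skips
      \<open>n + 1\<close>.\<close>
    define \<rho> where "\<rho> j = (if j \<le> n then j else j + 1)" for j
    have warp: "time_warp n z = z \<circ> \<sigma>"
      by (auto simp: time_warp_def \<sigma>_def)
    show ?thesis
      unfolding warp
    proof (rule ISS_idem_reindex)
      show "mono \<sigma>" "mono \<rho>"
        by (auto simp: mono_def \<sigma>_def \<rho>_def)
      show "\<sigma> (\<rho> j) = j" for j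
        by (simp add: \<sigma>_def \<rho>_def)
    \<comment> \<open>\<sigma> lowers an index \<open>j\<close> only if \<open>j > n\<close>, and
      then \<open>j - 1 \<ge> n > s\<close> keeps it in the window.\<close>
    qed (use 2 in \<open>auto simp: \<sigma>_def \<rho>_def\<close>)
  qed
qed

end
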